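(* Let $p\ge 2$ be an integer. For any integer $k\ge1$ and any $n\in\mathbb{N}$ we have $$\left|M_{n,k}^{(p)}\right|=\frac{1}{n!}\cdot\frac{k}{(p-1)n+k}\cdot\prod_{l=k}^{n+k-1}\bigl((p-1)n+l\bigr)=\frac{k}{(p-1)n+k}\binom{pn+k-1}{n}.$$
   Context: $\mathbb{N}$ includes $0$. $M_{n,k}^{(p)}$ is the set of all tuples $\mathbf{u}=(u_1,\ldots,u_n)\in\mathbb{N}^n$ such that $1\le u_i\le (p-1)(i-1)+k$ for $1\le i\le n$ and $u_i\le u_j$ for $1\le i\le j\le n$. For $n=0$ it consists of the empty tuple only. *)

theory Defs
  imports Complex_Main
begin

text \<open>Tuples \<open>(u\<^sub>1, \<dots>, u\<^sub>n)\<close> of natural numbers are lists of length \<open>n\<close>. Lists are indexed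
  from \<open>0\<close>, so \<open>u\<^sub>i\<close> is \<open>u ! (i - 1)\<close>.\<close>

definition M :: "nat \<Rightarrow> nat \<Rightarrow> nat \<Rightarrow> nat list set" where
  "M p n k = {u. length u = n \<and>
     (\<forall>i\<in>{1..n}. 1 \<le> u ! (i - 1) \<and> u ! (i - 1) \<le> (p - 1) * (i - 1) + k) \<and>
     (\<forall>i j. 1 \<le> i \<and> i \<le> j \<and> j \<le> n \<longrightarrow> u ! (i - 1) \<le> u ! (j - 1))}"

end

theory Submission
  imports Defs
begin

text \<open>Splitting \<open>M\<close> according to whether \<open>u\<^sub>1 \<ge> 2\<close> (lower all entries by one) or \<open>u\<^sub>1 = 1\<close>
  (drop the first entry) gives, with \<open>q = p - 1\<close>, the recurrence
  \<open>f(n, k) = f(n, k - 1) + f(n - 1, k + q)\<close>, whose boundary values are \<open>f(0, k) = 1\<close> and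
  \<open>f(n, 0) = 0\<close> for \<open>n \<ge> 1\<close>. The closed form satisfies the same recurrence because
  \<open>k (x + n - 1) - (k - 1) x = n (k + q)\<close> for \<open>x = q n + k\<close>.\<close>

text \<open>Zero-based indices and \<open>sorted\<close> replace the shifted quantifiers, so that
  list lemmas apply. Membership is unfolded through this form from here on.\<close>

lemma M_iff:
  "u \<in> M p n k \<longleftrightarrow>
     length u = n \<and> sorted u \<and> (\<forall>i<n. 1 \<le> u ! i \<and> u ! i \<le> (p - 1) * i + k)"
proof -
  have bounds: "(\<forall>i\<in>{1..n}. P (i - 1)) \<longleftrightarrow> (\<forall>i<n. P i)" for P
  proof (intro iffI allI impI ballI)
    fix i assume "\<forall>i\<in>{1..n}. P (i - 1)" "i < n"
    then show "P i" by (auto dest: bspec[of _ _ "Suc i"])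
  qed auto
  have mono: "(\<forall>i j. 1 \<le> i \<and> i \<le> j \<and> j \<le> n \<longrightarrow> u ! (i - 1) \<le> u ! (j - 1)) \<longleftrightarrow> sorted u"
    if "length u = n"
  proof
    assume *: "\<forall>i j. 1 \<le> i \<and> i \<le> j \<and> j \<le> n \<longrightarrow> u ! (i - 1) \<le> u ! (j - 1)"
    show "sorted u"
      unfolding sorted_iff_nth_mono
    proof (intro allI impI)
      fix i j assume "i \<le> j" "j < length u"
      then show "u ! i \<le> u ! j"
        using *[rule_format, of "Suc i" "Suc j"] that by simp
    qed
  next
    assume "sorted u"
    then show "\<forall>i j. 1 \<le> i \<and> i \<le> j \<and> j \<le> n \<longrightarrow> u ! (i - 1) \<le> u ! (j - 1)"
      using that by (auto intro!: sorted_nth_mono)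
  qed
  show ?thesis
    unfolding M_def using bounds[of "\<lambda>i. 1 \<le> u ! i \<and> u ! i \<le> (p - 1) * i + k"] mono by auto
qed

lemma finite_M: "finite (M p n k)"
proof (rule finite_subset)
  show "M p n k \<subseteq> {u. set u \<subseteq> {..(p - 1) * n + k} \<and> length u = n}"
  proof
    fix u assume u: "u \<in> M p n k"
    have "u ! i \<le> (p - 1) * n + k" if "i < n" for i
    proof -
      have "u ! i \<le> (p - 1) * i + k" using u that by (simp add: M_iff)
      also have "\<dots> \<le> (p - 1) * n + k" using that by simp
      finally show ?thesis .
    qed
    then show "u \<in> {u. set u \<subseteq> {..(p - 1) * n + k} \<and> length u = n}"
      using u by (auto simp: M_iff in_set_conv_nth)
  qed
qed (simp add: finite_lists_length_eq)

lemma M_0: "M p 0 k = {[]}"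
  by (auto simp: M_iff)

lemma M_Suc_0: "M p (Suc n) 0 = {}"
  by (auto simp: M_iff All_less_Suc2)

text \<open>Dropping the head moves every entry one place to the left, so the bound at
  \<open>i + 1\<close> becomes the bound at \<open>i\<close> with \<open>p - 1\<close> added to the
  constant. A leading 1 keeps the list sorted because all entries are positive.\<close>

lemma Cons_1_in_M_iff: "1 # v \<in> M p (Suc n) (Suc k) \<longleftrightarrow> v \<in> M p n (Suc k + (p - 1))"
proof
  assume "1 # v \<in> M p (Suc n) (Suc k)"
  then show "v \<in> M p n (Suc k + (p - 1))"
    by (auto simp: M_iff All_less_Suc2 add_ac)
next
  assume v: "v \<in> M p n (Suc k + (p - 1))"
  then have "\<forall>y\<in>set v. 1 \<le> y"
    by (auto simp: M_iff in_set_conv_nth)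
  with v show "1 # v \<in> M p (Suc n) (Suc k)"
    by (auto simp: M_iff All_less_Suc2 add_ac)
qed

text \<open>Lowering all entries by one lowers all upper bounds by one, hence \<open>k\<close> by
  one. The first entry of a sorted list is its least, so the condition on the head keeps every
  lowered entry positive.\<close>

lemma map_Suc_in_M_iff:
  "map Suc v \<in> M p (Suc n) (Suc k) \<and> hd (map Suc v) \<noteq> 1 \<longleftrightarrow> v \<in> M p (Suc n) k"
proof
  assume L: "map Suc v \<in> M p (Suc n) (Suc k) \<and> hd (map Suc v) \<noteq> 1"
  then have len: "length v = Suc n" and srt: "sorted v"
    by (auto simp: M_iff sorted_iff_nth_mono)
  then have "v ! 0 \<noteq> 0"
    using L by (cases v) auto
  moreover have "v ! 0 \<le> v ! i" if "i < Suc n" for i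
    using sorted_nth_mono[OF srt, of 0 i] len that by simp
  ultimately have "1 \<le> v ! i" if "i < Suc n" for i
    using that by fastforce
  then show "v \<in> M p (Suc n) k"
    using L len srt by (auto simp: M_iff)
next
  assume R: "v \<in> M p (Suc n) k"
  then have "map Suc v \<in> M p (Suc n) (Suc k)"
    by (auto simp: M_iff sorted_iff_nth_mono)
  moreover have "hd (map Suc v) \<noteq> 1"
    using R by (cases v) (auto simp: M_iff All_less_Suc2)
  ultimately show "map Suc v \<in> M p (Suc n) (Suc k) \<and> hd (map Suc v) \<noteq> 1" ..
qed

lemma M_Suc_Suc:
  "M p (Suc n) (Suc k) = map Suc ` M p (Suc n) k \<union> (#) 1 ` M p n (Suc k + (p - 1))"
proof (intro equalityI subsetI)
  fix u assume u: "u \<in> M p (Suc n) (Suc k)"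
  show "u \<in> map Suc ` M p (Suc n) k \<union> (#) 1 ` M p n (Suc k + (p - 1))"
  proof (cases "hd u = 1")
    case True
    then have "u = 1 # tl u" using u by (cases u) (auto simp: M_iff)
    then show ?thesis using u Cons_1_in_M_iff by (metis UnI2 imageI)
  next
    case False
    \<comment> \<open>Positivity makes the truncated \<open>x - 1\<close> a true inverse of
      \<open>Suc\<close> on the entries.\<close>
    have "\<forall>y\<in>set u. 1 \<le> y" using u by (auto simp: M_iff in_set_conv_nth)
    then have eq: "u = map Suc (map (\<lambda>x. x - 1) u)"
      by (auto intro!: map_idI[symmetric])
    then have "map (\<lambda>x. x - 1) u \<in> M p (Suc n) k"
      using u False map_Suc_in_M_iff by metis
    then show ?thesis using eq by blast
  qed
next
  fix u assume "u \<in> map Suc ` M p (Suc n) k \<union> (#) 1 ` M p n (Suc k + (p - 1))"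
  then show "u \<in> M p (Suc n) (Suc k)"
    using Cons_1_in_M_iff map_Suc_in_M_iff by blast
qed

lemma card_M_Suc_Suc:
  "card (M p (Suc n) (Suc k)) = card (M p (Suc n) k) + card (M p n (Suc k + (p - 1)))"
proof -
  \<comment> \<open>Lists in the first image start with at least 2, those in the second with
    1.\<close>
  have "map Suc ` M p (Suc n) k \<inter> (#) 1 ` M p n (Suc k + (p - 1)) = {}"
    by (auto simp: M_iff All_less_Suc2)
  moreover have "card (map Suc ` M p (Suc n) k) = card (M p (Suc n) k)"
    by (rule card_image) (simp add: inj_on_def inj_map_eq_map)
  moreover have "card ((#) 1 ` M p n (Suc k + (p - 1))) = card (M p n (Suc k + (p - 1)))"
    by (rule card_image) simp
  ultimately show ?thesis
    by (simp add: M_Suc_Suc card_Un_disjoint finite_M)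
qed

text \<open>For positive length the denominator cancels the first factor of the product, which
  leaves a form free of division that also covers \<open>k = 0\<close>. The outer induction keeps
  \<open>k\<close> arbitrary because dropping the head raises it by \<open>p - 1\<close>; the inner
  one runs over \<open>k\<close>.\<close>

lemma fact_mult_card_M_Suc:
  "fact (Suc n) * real (card (M p (Suc n) k)) =
     real k * pochhammer (real ((p - 1) * Suc n + k) + 1) n"
proof (induction n arbitrary: k)
  case 0
  show ?case
  proof (induction k)
    case (Suc k)
    then show ?case by (simp add: card_M_Suc_Suc M_0)
  qed (simp add: M_Suc_0)
next
  case (Suc n)
  note outer_IH = Suc.IH
  show ?case
  proof (induction k)
    case (Suc k)
    \<comment> \<open>Lowering \<open>k\<close> by one turns the base \<open>x + 1\<close> into
      \<open>x\<close>, while dropping the head leaves it at \<open>x + 1\<close>. All terms are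
      therefore multiples of \<open>P\<close>.\<close>
    define x where "x = real ((p - 1) * Suc (Suc n) + Suc k)"
    define P where "P = pochhammer (x + 1) n"
    have "fact (Suc (Suc n)) * real (card (M p (Suc (Suc n)) k)) = real k * pochhammer x (Suc n)"
      using Suc.IH by (simp add: x_def add_ac)
    also have "pochhammer x (Suc n) = x * P"
      by (simp add: pochhammer_rec P_def)
    finally have lower: "fact (Suc (Suc n)) * real (card (M p (Suc (Suc n)) k)) = real k * (x * P)" .
    have "fact (Suc n) * real (card (M p (Suc n) (Suc k + (p - 1)))) =
        real (Suc k + (p - 1)) * P"
      unfolding outer_IH P_def x_def by (simp add: add_ac)
    then have drop: "fact (Suc (Suc n)) * real (card (M p (Suc n) (Suc k + (p - 1)))) =
        real (Suc (Suc n)) * (real (Suc k + (p - 1)) * P)"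
      by (simp add: fact_Suc[of "Suc n"] mult.assoc del: fact_Suc)
    have "fact (Suc (Suc n)) * real (card (M p (Suc (Suc n)) (Suc k))) =
        real k * (x * P) + real (Suc (Suc n)) * (real (Suc k + (p - 1)) * P)"
      unfolding card_M_Suc_Suc of_nat_add distrib_left lower drop[unfolded of_nat_add] ..
    \<comment> \<open>Here (n + 2)(p - 1) = x - (k + 1), so the coefficient of \<open>P\<close> is k
      x + (n + 2)(k + 1) + x - (k + 1) = (k + 1)(x + n + 1).\<close>
    also have "\<dots> = real (Suc k) * (P * (x + 1 + real n))"
      by (simp add: x_def distrib_left distrib_right mult_ac add_ac)
    also have "P * (x + 1 + real n) = pochhammer (x + 1) (Suc n)"
      by (simp add: P_def pochhammer_Suc)
    finally show ?case by (simp add: x_def)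
  qed (simp add: M_Suc_0)
qed

text \<open>Multiplying by the denominator restores the first factor of the rising factorial and
  brings in \<open>n = 0\<close>, where both sides are \<open>k\<close>.\<close>

lemma fact_mult_card_M:
  assumes "k \<ge> 1"
  shows "real ((p - 1) * n + k) * (fact n * real (card (M p n k))) =
    real k * pochhammer (real ((p - 1) * n + k)) n"
proof (cases n)
  case 0
  then show ?thesis by (simp add: M_0)
next
  case (Suc m)
  then show ?thesis
    by (simp only: fact_mult_card_M_Suc pochhammer_rec mult.left_commute)
qed

lemma prod_shift_eq_pochhammer:
  assumes "k \<ge> 1"
  shows "(\<Prod>l = k..n + k - 1. real (a + l)) = pochhammer (real (a + k)) n"
proof -
  \<comment> \<open>With \<open>k \<ge> 1\<close> the subtraction does not truncate, and the
    interval is empty for \<open>n = 0\<close>.\<close>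
  have "{k..n + k - 1} = {0 + k..<n + k}" using assms by auto
  then have "(\<Prod>l = k..n + k - 1. real (a + l)) = (\<Prod>l = 0..<n. real (a + (l + k)))"
    by (simp only: prod.shift_bounds_nat_ivl)
  then show ?thesis by (simp add: pochhammer_prod add_ac)
qed

theorem theorem4p6:
  fixes p k n :: nat
  assumes "p \<ge> 2" and "k \<ge> 1"
  shows "real (card (M p n k)) =
           1 / fact n * (real k / real ((p - 1) * n + k)) *
           (\<Prod>l = k..n + k - 1. real ((p - 1) * n + l))
       \<and> 1 / fact n * (real k / real ((p - 1) * n + k)) *
           (\<Prod>l = k..n + k - 1. real ((p - 1) * n + l)) =
         real k / real ((p - 1) * n + k) * real ((p * n + k - 1) choose n)"
proof -
  define x where "x = real ((p - 1) * n + k)"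
  have "x > 0" unfolding x_def of_nat_0_less_iff using assms by simp
  have "p * n + k - 1 = (p - 1) * n + n + k - 1"
    using assms by (cases p) auto
  then have "real (p * n + k - 1) = x + real n - 1"
    using assms by (simp add: x_def of_nat_diff)
  \<comment> \<open>The falling product from x + n - 1 with n factors ends at x, so read upwards it
    is the rising factorial of \<open>x\<close>.\<close>
  then have "real ((p * n + k - 1) choose n) = pochhammer x n / fact n"
    by (simp add: binomial_gbinomial gbinomial_pochhammer')
  moreover have "real (card (M p n k)) = 1 / fact n * (real k / x) * pochhammer x n"
    using fact_mult_card_M[OF assms(2), of p n, folded x_def] \<open>x > 0\<close>
    by (simp add: field_simps)
  ultimately show ?thesis
    unfolding prod_shift_eq_pochhammer[OF assms(2)] x_def[symmetric] by simp
qed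

end
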